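(* Let $1\le m\le n$ and let $\{\varphi_i\}_{i=1}^n$ be an equiangular tight frame (ETF) for $\mathbb{F}^m$, where $\mathbb{F}\in\{\mathbb{R},\mathbb{C}\}$, with synthesis operator $\Phi$, and let $\alpha=\frac nm$. (a) If $\mathbb{F}=\mathbb{R}$ and $m<n$, let $\beta=\left[\frac{n-m}{m(n-1)}\right]^{1/2}$. Then the $n$-vertex graph whose adjacency matrix is $A=\frac1{2\beta}\Phi^*\Phi-\frac{\beta+1}{2\beta}I+\frac12J$ is regular if and only if $\mathbf{1}$ is an eigenvector of the Gram matrix $\Phi^*\Phi$. (b) In general ($\mathbb{F}=\mathbb{R}$ or $\mathbb{C}$), $\mathbf{1}$ is an eigenvector of $\Phi^*\Phi$ if and only if either: (i) $\Phi^*\Phi\mathbf{1}=\mathbf{0}$, which occurs precisely when $\mathbf{1}$ lies in the null space of $\Phi$, or (ii) $\Phi^*\Phi\mathbf{1}=\alpha\mathbf{1}$, which occurs precisely when $\mathbf{1}$ lies in the column space of $\Phi^*$.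
   Context: For vectors $\{\varphi_i\}_{i=1}^n$ in $\mathbb{F}^m$, the synthesis operator $\Phi$ is the $m\times n$ matrix whose $i$th column is $\varphi_i$; $\Phi^*$ is its conjugate transpose and $\Phi^*\Phi$ is the $n\times n$ Gram matrix. The sequence is an equiangular tight frame (ETF) for $\mathbb{F}^m$ if every $\varphi_i$ has unit norm, $|\langle\varphi_i,\varphi_j\rangle|$ is constant over all $i\neq j$, and $\Phi\Phi^*=\alpha I$ for some $\alpha>0$ (necessarily $\alpha=\frac nm$). For an ETF the constant value of $|\langle\varphi_i,\varphi_j\rangle|$, $i\ne j$, is the Welch bound $\left[\frac{n-m}{m(n-1)}\right]^{1/2}$. Thus, for a real ETF with $m<n$, the matrix $A$ in (a) has zero diagonal and has entry $1$ (respectively $0$) at an off-diagonal position $(i,j)$ where $\langle\varphi_i,\varphi_j\rangle=\beta$ (respectively $-\beta$). Here $\mathbf{1}\in\mathbb{F}^n$ is the all-ones vector, $J=\mathbf{1}\mathbf{1}^*$ is the all-ones matrix, and $I$ is the identity matrix. A graph is regular if all its vertices have the same number of neighbors. *)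

theory Defs
  imports
    "Jordan_Normal_Form.Schur_Decomposition"
    "Jordan_Normal_Form.Matrix_Kernel"
    "Jordan_Normal_Form.VS_Connect"
    "Graph_Theory.Pair_Digraph"
begin

text \<open>
  Vectors, matrices and graph vertices are indexed from 0, so that a sequence of \<open>n\<close> vectors
  is a function on naturals of which only the values at \<open>i < n\<close> matter. The sort
  \<open>{conjugatable_field, real_normed_field}\<close> lets the real and the complex case share their
  definitions; on the reals \<open>conjugate\<close> is the identity.
\<close>

definition synthesis_op :: "nat \<Rightarrow> nat \<Rightarrow> (nat \<Rightarrow> 'a vec) \<Rightarrow> 'a mat" where
  "synthesis_op m n \<phi> = mat_of_cols m (map \<phi> [0..<n])"

definition gram_matrix ::
  "nat \<Rightarrow> nat \<Rightarrow> (nat \<Rightarrow> 'a :: conjugatable_field vec) \<Rightarrow> 'a mat" where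
  "gram_matrix m n \<phi> = mat_adjoint (synthesis_op m n \<phi>) * synthesis_op m n \<phi>"

definition euclidean_norm :: "'a :: real_normed_field vec \<Rightarrow> real" where
  "euclidean_norm v = sqrt (\<Sum>i<dim_vec v. (norm (v $ i))\<^sup>2)"

definition is_etf ::
  "nat \<Rightarrow> nat \<Rightarrow> (nat \<Rightarrow> 'a :: {conjugatable_field, real_normed_field} vec) \<Rightarrow> bool" where
  "is_etf m n \<phi> \<longleftrightarrow>
     (\<forall>i<n. \<phi> i \<in> carrier_vec m) \<and>
     (\<forall>i<n. euclidean_norm (\<phi> i) = 1) \<and>
     (\<exists>c. \<forall>i<n. \<forall>j<n. i \<noteq> j \<longrightarrow> norm (\<phi> i \<bullet>c \<phi> j) = c) \<and>
     (\<exists>a>0. synthesis_op m n \<phi> * mat_adjoint (synthesis_op m n \<phi>) = of_real a \<cdot>\<^sub>m 1\<^sub>m m)"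

definition all_ones_vec :: "nat \<Rightarrow> 'a :: one vec" where
  "all_ones_vec n = vec n (\<lambda>_. 1)"

definition all_ones_mat :: "nat \<Rightarrow> 'a :: one mat" where
  "all_ones_mat n = mat n n (\<lambda>_. 1)"

text \<open>
  \<open>pair_graph\<close> is the locale of finite loop-free symmetric digraphs without parallel arcs: each
  edge of the undirected simple graph is represented by its two opposite arcs.
\<close>

definition simple_graph_on :: "nat \<Rightarrow> nat pair_pre_digraph \<Rightarrow> bool" where
  "simple_graph_on n G \<longleftrightarrow> pair_graph G \<and> pverts G = {0..<n}"

definition adjacency_matrix :: "nat \<Rightarrow> nat pair_pre_digraph \<Rightarrow> real mat" where
  "adjacency_matrix n G = mat n n (\<lambda>(i, j). if (i, j) \<in> parcs G then 1 else 0)"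

text \<open>In a symmetric digraph without parallel arcs, the out-degree counts the neighbors.\<close>

definition regular_graph :: "'v pair_pre_digraph \<Rightarrow> bool" where
  "regular_graph G \<longleftrightarrow> (\<exists>k. \<forall>v\<in>pverts G. out_degree (with_proj G) v = k)"

end

theory Submission
  imports Defs
begin

text \<open>
  Since \<open>\<Phi>\<Phi>\<^sup>* = \<alpha>I\<close>, the Gram matrix \<open>G = \<Phi>\<^sup>*\<Phi>\<close> satisfies \<open>G\<^sup>2 = \<alpha>G\<close>, so its eigenvalues lie in
  \<open>{0, \<alpha>}\<close>; the kernel of \<open>G\<close> is that of \<open>\<Phi>\<close>, and the \<open>\<alpha>\<close>-eigenspace is the range of \<open>\<Phi>\<^sup>*\<close>.
  Comparing the traces of \<open>\<Phi>\<Phi>\<^sup>*\<close> and \<open>\<Phi>\<^sup>*\<Phi>\<close> gives \<open>\<alpha> = n/m\<close>. In the real case the diagonal of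
  \<open>G\<^sup>2 = \<alpha>G\<close> says that the squares in each row of \<open>G\<close> sum to \<open>n/m\<close>, which forces the off-diagonal
  entries to be \<open>\<plusminus>\<beta>\<close>. Hence \<open>A\<close> is a symmetric 0/1 matrix with zero diagonal, and its row sums,
  the vertex degrees, are constant exactly when those of \<open>G\<close> are.
\<close>

section \<open>Tight frames\<close>

lemma mat_adjoint_carrier [simp]:
  "A \<in> carrier_mat m n \<Longrightarrow> mat_adjoint A \<in> carrier_mat n m"
  unfolding mat_adjoint_def carrier_mat_def by simp

lemma mat_adjoint_index:
  "A \<in> carrier_mat m n \<Longrightarrow> i < n \<Longrightarrow> j < m \<Longrightarrow> mat_adjoint A $$ (i, j) = conjugate (A $$ (j, i))"
  unfolding mat_adjoint_def by (simp add: mat_of_rows_index)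

lemma all_ones_vec_carrier [simp]: "all_ones_vec n \<in> carrier_vec n"
  by (simp add: all_ones_vec_def)

lemma all_ones_vec_nonzero: "0 < n \<Longrightarrow> all_ones_vec n \<noteq> (0\<^sub>v n :: 'a :: zero_neq_one vec)"
  by (metis all_ones_vec_def index_vec index_zero_vec(1) zero_neq_one)

lemma smult_one_mat_mult_vec:
  fixes v :: "'a :: comm_ring_1 vec"
  assumes "v \<in> carrier_vec n"
  shows "(a \<cdot>\<^sub>m 1\<^sub>m n) *\<^sub>v v = a \<cdot>\<^sub>v v"
  using assms by (intro eq_vecI) auto

lemma mult_mat_zero_vec:
  fixes A :: "'a :: comm_ring_1 mat"
  assumes "A \<in> carrier_mat m n"
  shows "A *\<^sub>v 0\<^sub>v n = 0\<^sub>v m"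
  using assms by (intro eq_vecI) auto

lemma tight_frame_gram_mult_vec:
  fixes F :: "'a :: conjugatable_field mat"
  assumes F: "F \<in> carrier_mat m n"
    and tight: "F * mat_adjoint F = a \<cdot>\<^sub>m 1\<^sub>m m"
    and v: "v \<in> carrier_vec n"
  shows "F *\<^sub>v ((mat_adjoint F * F) *\<^sub>v v) = a \<cdot>\<^sub>v (F *\<^sub>v v)"
proof -
  have adj: "mat_adjoint F \<in> carrier_mat n m" using F by simp
  have "F *\<^sub>v ((mat_adjoint F * F) *\<^sub>v v) = (F * mat_adjoint F) *\<^sub>v (F *\<^sub>v v)"
    using assoc_mult_mat_vec[OF adj F v] assoc_mult_mat_vec[OF F adj, of "F *\<^sub>v v"] F v by simp
  also have "\<dots> = a \<cdot>\<^sub>v (F *\<^sub>v v)"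
    using F v by (simp add: tight smult_one_mat_mult_vec)
  finally show ?thesis .
qed

text \<open>Here \<open>F F\<^sup>*\<close> appears in the middle of
  \<open>F\<^sup>* F F\<^sup>* y\<close> and collapses to a scalar. So every nonzero vector in the
  range of the adjoint is an eigenvector for \<open>a\<close>.\<close>

lemma tight_frame_gram_adjoint_mult_vec:
  fixes F :: "'a :: conjugatable_field mat"
  assumes F: "F \<in> carrier_mat m n"
    and tight: "F * mat_adjoint F = a \<cdot>\<^sub>m 1\<^sub>m m"
    and y: "y \<in> carrier_vec m"
  shows "(mat_adjoint F * F) *\<^sub>v (mat_adjoint F *\<^sub>v y) = a \<cdot>\<^sub>v (mat_adjoint F *\<^sub>v y)"
proof -
  have adj: "mat_adjoint F \<in> carrier_mat n m" using F by simp
  have "(mat_adjoint F * F) *\<^sub>v (mat_adjoint F *\<^sub>v y) = mat_adjoint F *\<^sub>v (F *\<^sub>v (mat_adjoint F *\<^sub>v y))"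
    using mult_mat_vec_carrier[OF adj y] by (rule assoc_mult_mat_vec[OF adj F])
  also have "F *\<^sub>v (mat_adjoint F *\<^sub>v y) = a \<cdot>\<^sub>v y"
    using y by (simp add: assoc_mult_mat_vec[OF F adj y, symmetric] tight smult_one_mat_mult_vec)
  finally show ?thesis
    using adj y by (simp add: mult_mat_vec)
qed

text \<open>The usual argument through positivity of the squared norm of \<open>F v\<close> makes no
  sense over a general \<open>conjugatable_field\<close>. Applying \<open>F\<close> to
  \<open>F\<^sup>* F v = 0\<close> gives \<open>a F v = 0\<close> instead, and \<open>a\<close> can
  be cancelled.\<close>

lemma tight_frame_gram_eq_zero_iff:
  fixes F :: "'a :: conjugatable_field mat"
  assumes F: "F \<in> carrier_mat m n"
    and tight: "F * mat_adjoint F = a \<cdot>\<^sub>m 1\<^sub>m m" and "a \<noteq> 0"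
    and v: "v \<in> carrier_vec n"
  shows "(mat_adjoint F * F) *\<^sub>v v = 0\<^sub>v n \<longleftrightarrow> v \<in> mat_kernel F"
proof
  have adj: "mat_adjoint F \<in> carrier_mat n m" using F by simp
  show "v \<in> mat_kernel F" if "(mat_adjoint F * F) *\<^sub>v v = 0\<^sub>v n"
  proof (rule mat_kernelI[OF F v])
    have "a \<cdot>\<^sub>v (F *\<^sub>v v) = 0\<^sub>v m"
      using tight_frame_gram_mult_vec[OF F tight v] that mult_mat_zero_vec[OF F] by simp
    then have "inverse a \<cdot>\<^sub>v (a \<cdot>\<^sub>v (F *\<^sub>v v)) = inverse a \<cdot>\<^sub>v 0\<^sub>v m" by simp
    also have "\<dots> = 0\<^sub>v m" by (intro eq_vecI) auto
    finally show "F *\<^sub>v v = 0\<^sub>v m" using \<open>a \<noteq> 0\<close> by (simp add: smult_smult_assoc)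
  qed
  show "(mat_adjoint F * F) *\<^sub>v v = 0\<^sub>v n" if "v \<in> mat_kernel F"
    using mat_kernelD[OF F that] mult_mat_zero_vec[OF adj] by (simp add: assoc_mult_mat_vec[OF adj F])
qed

text \<open>Dividing the eigenvalue equation by \<open>a\<close> exhibits \<open>v\<close> as the
  adjoint applied to \<open>F v / a\<close>; conversely the Gram matrix scales the whole range of
  the adjoint by \<open>a\<close>.\<close>

lemma tight_frame_gram_eq_smult_iff:
  fixes F :: "'a :: conjugatable_field mat"
  assumes F: "F \<in> carrier_mat m n"
    and tight: "F * mat_adjoint F = a \<cdot>\<^sub>m 1\<^sub>m m" and "a \<noteq> 0"
    and v: "v \<in> carrier_vec n"
  shows "(mat_adjoint F * F) *\<^sub>v v = a \<cdot>\<^sub>v v \<longleftrightarrow> v \<in> vec_space.col_space n (mat_adjoint F)"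
proof -
  have adj: "mat_adjoint F \<in> carrier_mat n m" using F by simp
  have range: "v \<in> vec_space.col_space n (mat_adjoint F) \<longleftrightarrow>
      (\<exists>y\<in>carrier_vec m. mat_adjoint F *\<^sub>v y = v)"
    using vec_space.col_space_eq[OF adj] adj v by auto
  show ?thesis
    unfolding range
  proof
    assume eig: "(mat_adjoint F * F) *\<^sub>v v = a \<cdot>\<^sub>v v"
    have "mat_adjoint F *\<^sub>v (inverse a \<cdot>\<^sub>v (F *\<^sub>v v)) = inverse a \<cdot>\<^sub>v ((mat_adjoint F * F) *\<^sub>v v)"
      using F v by (simp add: mult_mat_vec[OF adj] assoc_mult_mat_vec[OF adj F v])
    also have "\<dots> = v"
      using \<open>a \<noteq> 0\<close> by (simp add: eig smult_smult_assoc)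
    finally show "\<exists>y\<in>carrier_vec m. mat_adjoint F *\<^sub>v y = v"
      using F v by (intro bexI[of _ "inverse a \<cdot>\<^sub>v (F *\<^sub>v v)"]) auto
  next
    assume "\<exists>y\<in>carrier_vec m. mat_adjoint F *\<^sub>v y = v"
    then show "(mat_adjoint F * F) *\<^sub>v v = a \<cdot>\<^sub>v v"
      using tight_frame_gram_adjoint_mult_vec[OF F tight] by auto
  qed
qed

text \<open>An eigenvector for some \<open>k \<noteq> 0\<close> lies in the range of the adjoint,
  being the image of \<open>F v / k\<close>, and on that range the Gram matrix acts as
  \<open>a\<close>.\<close>

lemma tight_frame_gram_eigenvector_iff:
  fixes F :: "'a :: conjugatable_field mat"
  assumes F: "F \<in> carrier_mat m n"
    and tight: "F * mat_adjoint F = a \<cdot>\<^sub>m 1\<^sub>m m" and "a \<noteq> 0"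
    and v: "v \<in> carrier_vec n" and "v \<noteq> 0\<^sub>v n"
  shows "(\<exists>k. eigenvector (mat_adjoint F * F) v k) \<longleftrightarrow>
    (mat_adjoint F * F) *\<^sub>v v = 0\<^sub>v n \<or> (mat_adjoint F * F) *\<^sub>v v = a \<cdot>\<^sub>v v"
proof -
  let ?G = "mat_adjoint F * F"
  have adj: "mat_adjoint F \<in> carrier_mat n m" using F by simp
  then have eig: "eigenvector ?G v k \<longleftrightarrow> ?G *\<^sub>v v = k \<cdot>\<^sub>v v" for k
    using \<open>v \<noteq> 0\<^sub>v n\<close> v by (simp add: eigenvector_def)
  show ?thesis
    unfolding eig
  proof
    assume "\<exists>k. ?G *\<^sub>v v = k \<cdot>\<^sub>v v"
    then obtain k where k: "?G *\<^sub>v v = k \<cdot>\<^sub>v v" by blast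
    show "?G *\<^sub>v v = 0\<^sub>v n \<or> ?G *\<^sub>v v = a \<cdot>\<^sub>v v"
    proof (cases "k = 0")
      case True
      then show ?thesis using k v by auto
    next
      case False
      have "mat_adjoint F *\<^sub>v (inverse k \<cdot>\<^sub>v (F *\<^sub>v v)) = inverse k \<cdot>\<^sub>v (?G *\<^sub>v v)"
        using F v by (simp add: mult_mat_vec[OF adj] assoc_mult_mat_vec[OF adj F v])
      also have "\<dots> = v"
        using False by (simp add: k smult_smult_assoc)
      finally have "mat_adjoint F *\<^sub>v (inverse k \<cdot>\<^sub>v (F *\<^sub>v v)) = v" .
      then show ?thesis
        using tight_frame_gram_adjoint_mult_vec[OF F tight, of "inverse k \<cdot>\<^sub>v (F *\<^sub>v v)"] F v by simp
    qed
  next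
    assume "?G *\<^sub>v v = 0\<^sub>v n \<or> ?G *\<^sub>v v = a \<cdot>\<^sub>v v"
    \<comment> \<open>The kernel case is the eigenvalue 0.\<close>
    moreover have "0\<^sub>v n = 0 \<cdot>\<^sub>v v" using v by auto
    ultimately show "\<exists>k. ?G *\<^sub>v v = k \<cdot>\<^sub>v v" by metis
  qed
qed

section \<open>Equiangular tight frames\<close>

lemma synthesis_op_carrier [simp]: "synthesis_op m n \<phi> \<in> carrier_mat m n"
  unfolding synthesis_op_def using mat_of_cols_carrier(1)[of m "map \<phi> [0..<n]"] by simp

lemma synthesis_op_index:
  "i < m \<Longrightarrow> j < n \<Longrightarrow> synthesis_op m n \<phi> $$ (i, j) = \<phi> j $ i"
  by (simp add: synthesis_op_def mat_of_cols_index)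

lemma gram_matrix_carrier [simp]: "gram_matrix m n \<phi> \<in> carrier_mat n n"
  unfolding gram_matrix_def by (rule mult_carrier_mat[of _ n m]) simp_all

lemma mult_mat_index_sum:
  assumes "A \<in> carrier_mat p q" "B \<in> carrier_mat q r" "i < p" "j < r"
  shows "(A * B) $$ (i, j) = (\<Sum>k<q. A $$ (i, k) * B $$ (k, j))"
  using assms by (simp add: scalar_prod_def atLeast0LessThan)

lemma gram_matrix_index_sum:
  fixes \<phi> :: "nat \<Rightarrow> 'a :: conjugatable_field vec"
  assumes "i < n" "j < n"
  shows "gram_matrix m n \<phi> $$ (i, j) = (\<Sum>k<m. conjugate (\<phi> i $ k) * \<phi> j $ k)"
  unfolding gram_matrix_def using assms
  by (subst mult_mat_index_sum[of _ n m _ n])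
    (simp_all add: mat_adjoint_index[of _ m n] synthesis_op_index)

text \<open>Double counting of the squared moduli of all entries of the synthesis matrix: each of
  the \<open>m\<close> rows contributes \<open>a\<close> and each of the \<open>n\<close> columns
  contributes 1. The sort alone does not relate \<open>conjugate\<close> to \<open>norm\<close>, so
  \<open>conj\<close> supplies the link.\<close>

lemma etf_tight_constant:
  fixes \<phi> :: "nat \<Rightarrow> 'a :: {conjugatable_field, real_normed_field} vec"
  assumes conj: "\<And>x :: 'a. x * conjugate x = of_real ((norm x)\<^sup>2)"
    and etf: "is_etf m n \<phi>" and "0 < m"
  shows "synthesis_op m n \<phi> * mat_adjoint (synthesis_op m n \<phi>) = (of_nat n / of_nat m) \<cdot>\<^sub>m 1\<^sub>m m"
proof -
  let ?F = "synthesis_op m n \<phi>"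
  obtain a where a: "?F * mat_adjoint ?F = of_real a \<cdot>\<^sub>m 1\<^sub>m m"
    using etf unfolding is_etf_def by blast
  have row: "(\<Sum>j<n. (norm (\<phi> j $ i))\<^sup>2) = a" if i: "i < m" for i
  proof -
    have "(of_real a :: 'a) = (?F * mat_adjoint ?F) $$ (i, i)"
      using i by (simp add: a)
    also have "\<dots> = (\<Sum>j<n. \<phi> j $ i * conjugate (\<phi> j $ i))"
      using i by (subst mult_mat_index_sum[of _ m n _ m])
        (simp_all add: mat_adjoint_index[of _ m n] synthesis_op_index)
    also have "\<dots> = of_real (\<Sum>j<n. (norm (\<phi> j $ i))\<^sup>2)"
      by (simp add: conj)
    finally show ?thesis by (simp only: of_real_eq_iff)
  qed
  have col: "(\<Sum>i<m. (norm (\<phi> j $ i))\<^sup>2) = 1" if "j < n" for j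
  proof -
    have "dim_vec (\<phi> j) = m" "euclidean_norm (\<phi> j) = 1"
      using etf that unfolding is_etf_def by auto
    then show ?thesis by (simp add: euclidean_norm_def)
  qed
  have "real m * a = (\<Sum>i<m. \<Sum>j<n. (norm (\<phi> j $ i))\<^sup>2)"
    by (simp add: row)
  also have "\<dots> = (\<Sum>j<n. \<Sum>i<m. (norm (\<phi> j $ i))\<^sup>2)"
    by (rule sum.swap)
  also have "\<dots> = real n"
    by (simp add: col)
  finally have "a = real n / real m"
    using \<open>0 < m\<close> by (simp add: field_simps)
  then show ?thesis using a by simp
qed

text \<open>The three tight-frame equivalences at the all-ones vector; \<open>0 < m\<close> and
  \<open>0 < n\<close> make both the frame constant and this vector nonzero.\<close>

lemma etf_all_ones_eigenvector:
  fixes \<phi> :: "nat \<Rightarrow> 'a :: {conjugatable_field, real_normed_field} vec"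
  assumes conj: "\<And>x :: 'a. x * conjugate x = of_real ((norm x)\<^sup>2)"
    and etf: "is_etf m n \<phi>" and m: "0 < m" and n: "0 < n"
  shows "((\<exists>k. eigenvector (gram_matrix m n \<phi>) (all_ones_vec n) k) \<longleftrightarrow>
          gram_matrix m n \<phi> *\<^sub>v all_ones_vec n = 0\<^sub>v n \<or>
          gram_matrix m n \<phi> *\<^sub>v all_ones_vec n = (of_nat n / of_nat m) \<cdot>\<^sub>v all_ones_vec n) \<and>
       (gram_matrix m n \<phi> *\<^sub>v all_ones_vec n = 0\<^sub>v n \<longleftrightarrow>
          all_ones_vec n \<in> mat_kernel (synthesis_op m n \<phi>)) \<and>
       (gram_matrix m n \<phi> *\<^sub>v all_ones_vec n = (of_nat n / of_nat m) \<cdot>\<^sub>v all_ones_vec n \<longleftrightarrow>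
          all_ones_vec n \<in> vec_space.col_space n (mat_adjoint (synthesis_op m n \<phi>)))"
proof -
  note tight = etf_tight_constant[OF conj etf m]
  have ne: "(of_nat n / of_nat m :: 'a) \<noteq> 0" using m n by simp
  show ?thesis
    unfolding gram_matrix_def
    using tight_frame_gram_eigenvector_iff[OF synthesis_op_carrier tight ne all_ones_vec_carrier
        all_ones_vec_nonzero[OF n]]
      tight_frame_gram_eq_zero_iff[OF synthesis_op_carrier tight ne all_ones_vec_carrier]
      tight_frame_gram_eq_smult_iff[OF synthesis_op_carrier tight ne all_ones_vec_carrier]
    by blast
qed

section \<open>Real equiangular tight frames and graphs\<close>

lemma gram_matrix_real_sym:
  fixes \<phi> :: "nat \<Rightarrow> real vec"
  assumes "i < n" "j < n"
  shows "gram_matrix m n \<phi> $$ (i, j) = gram_matrix m n \<phi> $$ (j, i)"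
  using assms by (simp add: gram_matrix_index_sum mult.commute)

lemma real_etf_gram_diag:
  fixes \<phi> :: "nat \<Rightarrow> real vec"
  assumes etf: "is_etf m n \<phi>" and i: "i < n"
  shows "gram_matrix m n \<phi> $$ (i, i) = 1"
proof -
  have "dim_vec (\<phi> i) = m" "euclidean_norm (\<phi> i) = 1"
    using etf i unfolding is_etf_def by auto
  then show ?thesis
    using i by (simp add: gram_matrix_index_sum euclidean_norm_def power2_eq_square)
qed

text \<open>A diagonal entry of \<open>G\<^sup>2 = (n/m) G\<close> reads
  \<open>n/m = 1 + (n - 1) c\<^sup>2\<close>, where \<open>c\<close> is the common modulus off the
  diagonal; solving for \<open>c\<close> gives the bound.\<close>

lemma real_etf_welch_bound:
  fixes \<phi> :: "nat \<Rightarrow> real vec"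
  assumes etf: "is_etf m n \<phi>" and m: "0 < m" and n: "1 < n"
    and ij: "i < n" "j < n" "i \<noteq> j"
  shows "\<bar>gram_matrix m n \<phi> $$ (i, j)\<bar> = sqrt ((real n - real m) / (real m * (real n - 1)))"
proof -
  let ?F = "synthesis_op m n \<phi>"
  let ?G = "gram_matrix m n \<phi>"
  have "\<exists>c. \<forall>i<n. \<forall>j<n. i \<noteq> j \<longrightarrow> norm (\<phi> i \<bullet>c \<phi> j) = c"
    using etf by (simp only: is_etf_def)
  then obtain c where c: "\<forall>i<n. \<forall>j<n. i \<noteq> j \<longrightarrow> norm (\<phi> i \<bullet>c \<phi> j) = c" ..
  have dim: "dim_vec (\<phi> i) = m" if "i < n" for i
    using etf that unfolding is_etf_def by auto
  have off: "\<bar>?G $$ (i, j)\<bar> = c" if "i < n" "j < n" "i \<noteq> j" for i j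
  proof -
    \<comment> \<open>The adjoint conjugates column \<open>i\<close>, so the arguments come out
      swapped; \<open>c\<close> serves both orders.\<close>
    have "?G $$ (i, j) = \<phi> j \<bullet>c \<phi> i"
      using that dim by (simp add: gram_matrix_index_sum scalar_prod_def atLeast0LessThan mult.commute)
    then show ?thesis using c that by simp
  qed
  have adj: "mat_adjoint ?F \<in> carrier_mat n m" by simp
  have tight: "?F * mat_adjoint ?F = (real n / real m) \<cdot>\<^sub>m 1\<^sub>m m"
    by (rule etf_tight_constant[OF _ etf m]) (simp add: power2_eq_square)
  have "?G * ?G = mat_adjoint ?F * (?F * (mat_adjoint ?F * ?F))"
    unfolding gram_matrix_def
    by (rule assoc_mult_mat[OF adj synthesis_op_carrier mult_carrier_mat[OF adj synthesis_op_carrier]])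
  also have "?F * (mat_adjoint ?F * ?F) = (?F * mat_adjoint ?F) * ?F"
    by (rule assoc_mult_mat[OF synthesis_op_carrier adj synthesis_op_carrier, symmetric])
  also have "\<dots> = (real n / real m) \<cdot>\<^sub>m (1\<^sub>m m * ?F)"
    unfolding tight by (rule mult_smult_assoc_mat[OF one_carrier_mat synthesis_op_carrier])
  also have "1\<^sub>m m * ?F = ?F"
    by (rule left_mult_one_mat[OF synthesis_op_carrier])
  also have "mat_adjoint ?F * ((real n / real m) \<cdot>\<^sub>m ?F) = (real n / real m) \<cdot>\<^sub>m ?G"
    unfolding gram_matrix_def by (rule mult_smult_distrib[OF adj synthesis_op_carrier])
  finally have sq: "?G * ?G = (real n / real m) \<cdot>\<^sub>m ?G" .
  have "real n / real m = (?G * ?G) $$ (i, i)"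
    using ij real_etf_gram_diag[OF etf, of i] gram_matrix_carrier[of m n \<phi>]
    by (simp add: sq del: gram_matrix_carrier)
  \<comment> \<open>Symmetry of the real Gram matrix turns row times column into a sum of
    squares.\<close>
  also have "\<dots> = (\<Sum>k<n. (?G $$ (i, k))\<^sup>2)"
    using ij gram_matrix_real_sym[of i n _ m \<phi>]
    by (subst mult_mat_index_sum[of _ n n _ n]) (simp_all add: power2_eq_square)
  also have "\<dots> = (?G $$ (i, i))\<^sup>2 + (\<Sum>k\<in>{..<n} - {i}. (?G $$ (i, k))\<^sup>2)"
    using ij by (intro sum.remove) auto
  also have "(\<Sum>k\<in>{..<n} - {i}. (?G $$ (i, k))\<^sup>2) = (\<Sum>k\<in>{..<n} - {i}. c\<^sup>2)"
  proof (intro sum.cong refl)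
    fix k
    assume "k \<in> {..<n} - {i}"
    then have "\<bar>?G $$ (i, k)\<bar> = c" using ij off[of i k] by auto
    then show "(?G $$ (i, k))\<^sup>2 = c\<^sup>2" by (metis power2_abs)
  qed
  also have "\<dots> = (real n - 1) * c\<^sup>2"
    using ij by (simp add: of_nat_diff)
  finally have "real n / real m = 1 + (real n - 1) * c\<^sup>2"
    using ij real_etf_gram_diag[OF etf] by simp
  then have "c\<^sup>2 = (real n - real m) / (real m * (real n - 1))"
    using m n by (simp add: field_simps)
  \<comment> \<open>The given pair of distinct indices shows that \<open>c\<close> is an absolute
    value, which selects the nonnegative root.\<close>
  moreover have "0 \<le> c" using off[OF ij] by linarith
  ultimately show ?thesis
    using off[OF ij] by (metis real_sqrt_unique)
qed

section \<open>Simple graphs as symmetric 0/1 matrices, and degrees as row sums\<close>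

lemma ex1_graph_of_adjacency_matrix:
  assumes A: "A \<in> carrier_mat n n"
    and entries: "\<And>i j. i < n \<Longrightarrow> j < n \<Longrightarrow> A $$ (i, j) \<in> {0, 1}"
    and diag: "\<And>i. i < n \<Longrightarrow> A $$ (i, i) = 0"
    and sym: "\<And>i j. i < n \<Longrightarrow> j < n \<Longrightarrow> A $$ (i, j) = A $$ (j, i)"
  shows "\<exists>!G. simple_graph_on n G \<and> adjacency_matrix n G = A"
proof -
  define E where "E = {(i, j). i < n \<and> j < n \<and> A $$ (i, j) = 1}"
  define G :: "nat pair_pre_digraph" where "G = \<lparr>pverts = {0..<n}, parcs = E\<rparr>"
  have "finite E"
    by (rule finite_subset[of _ "{..<n} \<times> {..<n}"]) (auto simp: E_def)
  moreover have "symmetric G"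
    unfolding symmetric_def by (rule symI) (auto simp: G_def E_def sym)
  ultimately have "pair_graph G"
    by unfold_locales (auto simp: G_def E_def diag)
  then have "simple_graph_on n G"
    by (simp add: simple_graph_on_def G_def)
  moreover have "adjacency_matrix n G = A"
    using A entries by (intro eq_matI) (auto simp: adjacency_matrix_def G_def E_def)
  moreover have "H = G" if "simple_graph_on n H" "adjacency_matrix n H = A" for H
  proof -
    interpret pair_graph H using that(1) by (simp add: simple_graph_on_def)
    have verts: "pverts H = {0..<n}" using that(1) by (simp add: simple_graph_on_def)
    have "(i, j) \<in> parcs H \<longleftrightarrow> (i, j) \<in> E" for i j
    proof (cases "i < n \<and> j < n")
      case True
      then have "A $$ (i, j) = (if (i, j) \<in> parcs H then 1 else 0)"
        using that(2) by (auto simp: adjacency_matrix_def)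
      then show ?thesis using True by (auto simp: E_def)
    next
      case False
      \<comment> \<open>The matrix says nothing about indices outside the range; arcs there are
        excluded because their endpoints must be vertices.\<close>
      then show ?thesis using wellformed' verts by (force simp: E_def)
    qed
    then have "parcs H = E" by auto
    then show "H = G" using verts by (simp add: G_def)
  qed
  ultimately show ?thesis by blast
qed

lemma out_degree_eq_adjacency_row_sum:
  assumes G: "simple_graph_on n G" and i: "i < n"
  shows "real (out_degree (with_proj G) i) = (\<Sum>j<n. adjacency_matrix n G $$ (i, j))"
proof -
  interpret pair_graph G using G by (simp add: simple_graph_on_def)
  have verts: "pverts G = {0..<n}" using G by (simp add: simple_graph_on_def)
  \<comment> \<open>The head of an arc is a vertex, so restricting \<open>j\<close> below
    \<open>n\<close> loses nothing; injectivity of \<open>Pair i\<close> then allows counting heads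
    instead of arcs.\<close>
  have "out_arcs (with_proj G) i = Pair i ` {j \<in> {..<n}. (i, j) \<in> parcs G}"
    using in_arcsD2 verts by (force simp: out_arcs_def)
  then have "out_degree (with_proj G) i = card {j \<in> {..<n}. (i, j) \<in> parcs G}"
    by (simp add: out_degree_def card_image inj_on_def)
  also have "real \<dots> = (\<Sum>j<n. if (i, j) \<in> parcs G then 1 else 0)"
    by (simp add: sum.If_cases Int_def)
  also have "\<dots> = (\<Sum>j<n. adjacency_matrix n G $$ (i, j))"
    using i by (intro sum.cong) (auto simp: adjacency_matrix_def)
  finally show ?thesis .
qed

text \<open>Degrees are natural numbers and row sums are real; injectivity of \<open>of_nat\<close>
  makes their constancy equivalent.\<close>

lemma regular_graph_iff_row_sums:
  assumes G: "simple_graph_on n G"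
  shows "regular_graph G \<longleftrightarrow> (\<exists>r. \<forall>i<n. (\<Sum>j<n. adjacency_matrix n G $$ (i, j)) = r)"
proof -
  have verts: "v \<in> pverts G \<longleftrightarrow> v < n" for v using G by (simp add: simple_graph_on_def)
  show ?thesis
    unfolding regular_graph_def Ball_def verts
    using out_degree_eq_adjacency_row_sum[OF G] by (metis of_nat_eq_iff)
qed

text \<open>The entries of \<open>M\<close> applied to the all-ones vector are the row sums of
  \<open>M\<close>.\<close>

lemma all_ones_eigenvector_iff_row_sums:
  fixes M :: "'a :: comm_ring_1 mat"
  assumes M: "M \<in> carrier_mat n n" and n: "0 < n"
  shows "(\<exists>k. eigenvector M (all_ones_vec n) k) \<longleftrightarrow> (\<exists>r. \<forall>i<n. (\<Sum>j<n. M $$ (i, j)) = r)"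
proof -
  have "eigenvector M (all_ones_vec n) k \<longleftrightarrow> (\<forall>i<n. (\<Sum>j<n. M $$ (i, j)) = k)" for k
    using M all_ones_vec_nonzero[OF n, where 'a = 'a]
    by (auto simp: eigenvector_def all_ones_vec_def vec_eq_iff scalar_prod_def atLeast0LessThan)
  then show ?thesis by simp
qed

text \<open>The affine map defining \<open>A\<close> sends off-diagonal entries
  \<open>\<beta>\<close> to 1 and \<open>-\<beta>\<close> to 0, and the diagonal to
  \<open>(1 - (\<beta> + 1) + \<beta>) / (2 * \<beta>) = 0\<close>. It also acts affinely on row
  sums, with slope \<open>1 / (2 * \<beta>)\<close>, so constancy transfers both ways.\<close>

lemma real_etf_graph:
  fixes \<phi> :: "nat \<Rightarrow> real vec"
  assumes etf: "is_etf m n \<phi>" and m: "0 < m" and mn: "m < n"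
    and \<beta>: "\<beta> = sqrt ((real n - real m) / (real m * (real n - 1)))"
    and A: "A = (1 / (2 * \<beta>)) \<cdot>\<^sub>m gram_matrix m n \<phi>
      - ((\<beta> + 1) / (2 * \<beta>)) \<cdot>\<^sub>m 1\<^sub>m n + (1 / 2) \<cdot>\<^sub>m all_ones_mat n"
  shows "(\<exists>!G. simple_graph_on n G \<and> adjacency_matrix n G = A) \<and>
    (\<forall>G. simple_graph_on n G \<and> adjacency_matrix n G = A \<longrightarrow>
      (regular_graph G \<longleftrightarrow> (\<exists>k. eigenvector (gram_matrix m n \<phi>) (all_ones_vec n) k)))"
proof -
  let ?g = "\<lambda>i j. gram_matrix m n \<phi> $$ (i, j)"
  have "1 < n" using m mn by simp
  \<comment> \<open>Strictness of \<open>m < n\<close> matters here: for \<open>m = n\<close> the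
    divisor \<open>2 * \<beta>\<close> would vanish.\<close>
  then have pos: "0 < \<beta>" using m mn by (simp add: \<beta>)
  have A_carrier: "A \<in> carrier_mat n n"
    by (simp add: A all_ones_mat_def)
  have index: "A $$ (i, j) = ?g i j / (2 * \<beta>) - (if i = j then (\<beta> + 1) / (2 * \<beta>) else 0) + 1 / 2"
    if "i < n" "j < n" for i j
    using that carrier_matD[OF gram_matrix_carrier[of m n \<phi>]] by (simp add: A all_ones_mat_def)
  have diag: "A $$ (i, i) = 0" if "i < n" for i
    using that pos real_etf_gram_diag[OF etf that] by (simp add: index field_simps)
  have entries: "A $$ (i, j) \<in> {0, 1}" if "i < n" "j < n" for i j
  proof (cases "i = j")
    case True
    then show ?thesis using diag that by simp
  next
    case False
    then have "?g i j = \<beta> \<or> ?g i j = - \<beta>"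
      using real_etf_welch_bound[OF etf m \<open>1 < n\<close> that False] \<beta> by linarith
    then show ?thesis using False that pos by (auto simp: index)
  qed
  have sym: "A $$ (i, j) = A $$ (j, i)" if "i < n" "j < n" for i j
    using that gram_matrix_real_sym[of i n j m \<phi>] by (simp add: index)
  have row: "(\<Sum>j<n. A $$ (i, j)) =
      (\<Sum>j<n. ?g i j) / (2 * \<beta>) - (\<beta> + 1) / (2 * \<beta>) + real n / 2" if "i < n" for i
    using that
    by (simp add: index sum.distrib sum_subtractf sum_divide_distrib)
  have rows: "(\<exists>r. \<forall>i<n. (\<Sum>j<n. A $$ (i, j)) = r) \<longleftrightarrow> (\<exists>r. \<forall>i<n. (\<Sum>j<n. ?g i j) = r)"
  proof
    assume "\<exists>r. \<forall>i<n. (\<Sum>j<n. A $$ (i, j)) = r"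
    then obtain r where "\<forall>i<n. (\<Sum>j<n. A $$ (i, j)) = r" by blast
    \<comment> \<open>The constant comes from solving \<open>row\<close> for the Gram row
      sum.\<close>
    then have "\<forall>i<n. (\<Sum>j<n. ?g i j) = 2 * \<beta> * (r + (\<beta> + 1) / (2 * \<beta>) - real n / 2)"
      using row pos by (fastforce simp: field_simps)
    then show "\<exists>r. \<forall>i<n. (\<Sum>j<n. ?g i j) = r" by blast
  next
    assume "\<exists>r. \<forall>i<n. (\<Sum>j<n. ?g i j) = r"
    then show "\<exists>r. \<forall>i<n. (\<Sum>j<n. A $$ (i, j)) = r" using row by auto
  qed
  show ?thesis
  proof (intro conjI allI impI)
    show "\<exists>!G. simple_graph_on n G \<and> adjacency_matrix n G = A"
      by (rule ex1_graph_of_adjacency_matrix[OF A_carrier entries diag sym])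
  next
    fix G
    assume "simple_graph_on n G \<and> adjacency_matrix n G = A"
    then have "regular_graph G \<longleftrightarrow> (\<exists>r. \<forall>i<n. (\<Sum>j<n. A $$ (i, j)) = r)"
      using regular_graph_iff_row_sums by blast
    then show "regular_graph G \<longleftrightarrow> (\<exists>k. eigenvector (gram_matrix m n \<phi>) (all_ones_vec n) k)"
      using rows all_ones_eigenvector_iff_row_sums[OF gram_matrix_carrier, of n m \<phi>] \<open>1 < n\<close>
      by simp
  qed
qed

text \<open>Real and complex frames have different types, hence the two families. Existence and
  uniqueness of the graph keep the regularity claim in (a) from being vacuous.\<close>

theorem theorem3p1:
  fixes m n :: nat
    and \<phi> :: "nat \<Rightarrow> real vec"
    and \<psi> :: "nat \<Rightarrow> complex vec"
  assumes "1 \<le> m" and "m \<le> n"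
  shows
    "(is_etf m n \<phi> \<and> m < n \<longrightarrow>
       (let \<beta> = sqrt ((real n - real m) / (real m * (real n - 1)));
            A = (1 / (2 * \<beta>)) \<cdot>\<^sub>m gram_matrix m n \<phi>
                - ((\<beta> + 1) / (2 * \<beta>)) \<cdot>\<^sub>m 1\<^sub>m n
                + (1 / 2) \<cdot>\<^sub>m all_ones_mat n
        in (\<exists>!G. simple_graph_on n G \<and> adjacency_matrix n G = A) \<and>
           (\<forall>G. simple_graph_on n G \<and> adjacency_matrix n G = A \<longrightarrow>
              (regular_graph G \<longleftrightarrow>
                 (\<exists>k. eigenvector (gram_matrix m n \<phi>) (all_ones_vec n) k)))))
     \<and>
     (is_etf m n \<phi> \<longrightarrow>
       ((\<exists>k. eigenvector (gram_matrix m n \<phi>) (all_ones_vec n) k) \<longleftrightarrow>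
          gram_matrix m n \<phi> *\<^sub>v all_ones_vec n = 0\<^sub>v n \<or>
          gram_matrix m n \<phi> *\<^sub>v all_ones_vec n = (of_nat n / of_nat m) \<cdot>\<^sub>v all_ones_vec n) \<and>
       (gram_matrix m n \<phi> *\<^sub>v all_ones_vec n = 0\<^sub>v n \<longleftrightarrow>
          all_ones_vec n \<in> mat_kernel (synthesis_op m n \<phi>)) \<and>
       (gram_matrix m n \<phi> *\<^sub>v all_ones_vec n = (of_nat n / of_nat m) \<cdot>\<^sub>v all_ones_vec n \<longleftrightarrow>
          all_ones_vec n \<in> vec_space.col_space n (mat_adjoint (synthesis_op m n \<phi>))))
     \<and>
     (is_etf m n \<psi> \<longrightarrow>
       ((\<exists>k. eigenvector (gram_matrix m n \<psi>) (all_ones_vec n) k) \<longleftrightarrow>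
          gram_matrix m n \<psi> *\<^sub>v all_ones_vec n = 0\<^sub>v n \<or>
          gram_matrix m n \<psi> *\<^sub>v all_ones_vec n = (of_nat n / of_nat m) \<cdot>\<^sub>v all_ones_vec n) \<and>
       (gram_matrix m n \<psi> *\<^sub>v all_ones_vec n = 0\<^sub>v n \<longleftrightarrow>
          all_ones_vec n \<in> mat_kernel (synthesis_op m n \<psi>)) \<and>
       (gram_matrix m n \<psi> *\<^sub>v all_ones_vec n = (of_nat n / of_nat m) \<cdot>\<^sub>v all_ones_vec n \<longleftrightarrow>
          all_ones_vec n \<in> vec_space.col_space n (mat_adjoint (synthesis_op m n \<psi>))))"
proof -
  have m: "0 < m" and n: "0 < n" using assms by simp_all
  \<comment> \<open>Each field only has to supply this identity between conjugation and modulus; the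
    argument for (b) is otherwise common to both.\<close>
  have conj_real: "x * conjugate x = of_real ((norm x)\<^sup>2)" for x :: real
    by (simp add: power2_eq_square)
  have conj_complex: "x * conjugate x = of_real ((norm x)\<^sup>2)" for x :: complex
    by (simp only: conjugate_complex_def complex_norm_square)
  show ?thesis
    unfolding Let_def
    using real_etf_graph[OF _ m _ refl refl, of n \<phi>]
      etf_all_ones_eigenvector[OF conj_real _ m n, of \<phi>]
      etf_all_ones_eigenvector[OF conj_complex _ m n, of \<psi>]
    by (intro conjI impI) blast+
qed

end
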